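(* Let $F=f+g$ on $\mathbb{R}^d$, where $f$ is convex and $L$-smooth and $g$ is proper, lower semicontinuous and convex. Suppose $F$ is a proper, coercive, convex, lower semicontinuous and semi-algebraic function, and let $F_*=\min F$. Let $(x_\tau)_{\tau\ge1}$ be generated by the proximal gradient method PG from an initial point $x_0\in\operatorname{dom}F$. Then, as the total number of iterations $t\to\infty$, $$F(x_{t+1})-F_*=o(1/t)\qquad\text{and}\qquad \min_{1\le\tau\le t}\|G(x_\tau)\|_2=o(1/t).$$
   Context: A function $f$ is $L$-smooth ($L>0$) if it is differentiable with $\|\nabla f(x)-\nabla f(y)\|_2\le L\|x-y\|_2$ for all $x,y$. $F$ is coercive if $F(x)\to\infty$ as $\|x\|_2\to\infty$. A subset $S\subset\mathbb{R}^d$ is a real semi-algebraic set if there are finitely many real polynomial functions $g_{ij},h_{ij}:\mathbb{R}^d\to\mathbb{R}$ with $S=\bigcup_{j=1}^p\bigcap_{i=1}^q\{u\in\mathbb{R}^d: g_{ij}(u)=0\text{ and }h_{ij}(u)\le0\}$. A function $F$ is semi-algebraic if its graph $\{(u,s)\in\mathbb{R}^{d+1}:F(u)=s\}$ is a semi-algebraic set. Proximal mapping: $P_{\eta g}(u)=\arg\min_{x}\frac12\|x-u\|_2^2+\eta g(x)$. Proximal gradient: $G(x)=L(x-x^+)$ with $x^+=P_{g/L}(x-\nabla f(x)/L)$. PG: $x_1=x_0$ and $x_{\tau+1}=P_{g/L}(x_\tau-\nabla f(x_\tau)/L)$ for $\tau\ge1$. Option I returns the last iterate $x_{t+1}$ (the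 objective statement); Option II returns the iterate with smallest $\|G(x_\tau)\|_2$ (the proximal gradient statement). *)

theory Defs
  imports "HOL-Analysis.Analysis" "HOL-Library.Landau_Symbols"
begin

definition gradient :: "('a::real_inner \<Rightarrow> real) \<Rightarrow> 'a \<Rightarrow> 'a" where
  "gradient f x = (THE D. GDERIV f x :> D)"

definition L_smooth :: "real \<Rightarrow> ('a::real_inner \<Rightarrow> real) \<Rightarrow> bool" where
  "L_smooth L f \<longleftrightarrow> L > 0 \<and> (\<forall>x. f differentiable (at x)) \<and>
     (\<forall>x y. norm (gradient f x - gradient f y) \<le> L * norm (x - y))"

text \<open>Extended-valued functions take values in \<^typ>\<open>ereal\<close>.\<close>

definition effective_domain :: "('a \<Rightarrow> ereal) \<Rightarrow> 'a set" where
  "effective_domain F = {x. F x < \<infinity>}"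

definition proper_fun :: "('a \<Rightarrow> ereal) \<Rightarrow> bool" where
  "proper_fun F \<longleftrightarrow> (\<forall>x. F x \<noteq> -\<infinity>) \<and> effective_domain F \<noteq> {}"

definition lower_semicontinuous :: "('a::topological_space \<Rightarrow> ereal) \<Rightarrow> bool" where
  "lower_semicontinuous F \<longleftrightarrow> (\<forall>x. F x \<le> Liminf (at x) F)"

text \<open>In \<^typ>\<open>ereal\<close> we have \<open>0 * \<infinity> = 0\<close>, so the cases \<open>u = 0\<close> and \<open>v = 0\<close> below are
  harmless, and for functions that never take the value \<open>-\<infinity>\<close> the right-hand side is never of
  the form \<open>\<infinity> - \<infinity>\<close>.\<close>

definition ereal_convex :: "('a::real_vector \<Rightarrow> ereal) \<Rightarrow> bool" where
  "ereal_convex F \<longleftrightarrow> (\<forall>x y. \<forall>u\<ge>0. \<forall>v\<ge>0. u + v = 1 \<longrightarrow>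
     F (u *\<^sub>R x + v *\<^sub>R y) \<le> ereal u * F x + ereal v * F y)"

definition coercive :: "('a::real_normed_vector \<Rightarrow> ereal) \<Rightarrow> bool" where
  "coercive F \<longleftrightarrow> (F \<longlongrightarrow> \<infinity>) at_infinity"

definition semialgebraic_set :: "'a::euclidean_space set \<Rightarrow> bool" where
  "semialgebraic_set S \<longleftrightarrow> (\<exists>(p::nat) (q::nat) g h.
     (\<forall>i\<in>{1..q}. \<forall>j\<in>{1..p}. real_polynomial_function (g i j) \<and> real_polynomial_function (h i j)) \<and>
     S = (\<Union>j\<in>{1..p}. \<Inter>i\<in>{1..q}. {u. g i j u = 0 \<and> h i j u \<le> 0}))"

text \<open>The graph lives in the product with \<^typ>\<open>real\<close>: it only contains points over the
  effective domain.\<close>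

definition semialgebraic_fun :: "('a::euclidean_space \<Rightarrow> ereal) \<Rightarrow> bool" where
  "semialgebraic_fun F \<longleftrightarrow> semialgebraic_set {(u, s::real). F u = ereal s}"

definition prox :: "real \<Rightarrow> ('a::real_normed_vector \<Rightarrow> ereal) \<Rightarrow> 'a \<Rightarrow> 'a" where
  "prox \<eta> g u = arg_min (\<lambda>x. ereal (1/2 * (norm (x - u))\<^sup>2) + ereal \<eta> * g x) (\<lambda>x. True)"

definition pg_step :: "real \<Rightarrow> ('a::real_inner \<Rightarrow> real) \<Rightarrow> ('a \<Rightarrow> ereal) \<Rightarrow> 'a \<Rightarrow> 'a" where
  "pg_step L f g x = prox (1/L) g (x - (1/L) *\<^sub>R gradient f x)"

definition prox_gradient :: "real \<Rightarrow> ('a::real_inner \<Rightarrow> real) \<Rightarrow> ('a \<Rightarrow> ereal) \<Rightarrow> 'a \<Rightarrow> 'a" where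
  "prox_gradient L f g x = L *\<^sub>R (x - pg_step L f g x)"

definition pg_sequence ::
    "real \<Rightarrow> ('a::real_inner \<Rightarrow> real) \<Rightarrow> ('a \<Rightarrow> ereal) \<Rightarrow> (nat \<Rightarrow> 'a) \<Rightarrow> bool" where
  "pg_sequence L f g x \<longleftrightarrow> x 1 = x 0 \<and> (\<forall>\<tau>\<ge>1. x (\<tau> + 1) = pg_step L f g (x \<tau>))"

end

theory Submission
  imports Defs
begin

text \<open>
  Both rates come from one inequality for a step \<open>x\<^sup>+\<close> of the method
  (lemma \<open>pg_step_three_point\<close>): for every \<open>y\<close> with \<open>F y < \<infinity>\<close>,
  \<open>F x\<^sup>+ + L/2 \<bar>y - x\<^sup>+\<bar>\<^sup>2 \<le> F y + L/2 \<bar>y - x\<bar>\<^sup>2\<close>.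
  The step minimizes \<open>f x + \<langle>\<nabla>f x, \<sqdot> - x\<rangle> + L/2 \<bar>\<sqdot> - x\<bar>\<^sup>2 + g\<close>, which majorizes \<open>F\<close>
  because \<open>f\<close> is \<open>L\<close>-smooth, exceeds \<open>F\<close> by at most the quadratic term because \<open>f\<close> is convex,
  and grows quadratically away from its minimizer because \<open>g\<close> is convex.

  With \<open>y\<close> a minimizer of \<open>F\<close> the right-hand side telescopes along the iteration, so the
  optimality gaps \<open>D\<^sub>n = F x\<^sub>n - F\<^sub>*\<close> are summable. With \<open>y = x\<close> the gaps are seen to decrease.
  A decreasing summable sequence is \<open>o(1/n)\<close>, since its terms over the window \<open>[n/2, n)\<close> add up to a
  tail of a convergent series and all of them are at least the \<open>n\<close>-th term; this is the first rate.

  The choice \<open>y = x\<close> also gives \<open>\<bar>G x\<^sub>n\<bar>\<^sup>2 \<le> 2 L (D\<^sub>n - D\<^sub>n\<^sub>+\<^sub>1)\<close>. Over the window \<open>(t/2, t]\<close> these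
  squares add up to at most \<open>2 L\<close> times the gap at the beginning of the window, which is
  \<open>o(1/t)\<close>, so the smallest of the roughly \<open>t/2\<close> squares is \<open>o(1/t\<^sup>2)\<close>; this is the second rate.

  Minimizers of \<open>F\<close> and of the majorant exist because both functions are lower semicontinuous
  and coercive; the majorant inherits coercivity from \<open>F\<close>.
\<close>

section \<open>Attainment of minima\<close>

lemma lower_semicontinuous_eventually_greater:
  assumes "lower_semicontinuous H" "c < H x"
  shows "eventually (\<lambda>y. c < H y) (nhds x)"
proof -
  have "eventually (\<lambda>y. c < H y) (at x)"
    using assms unfolding lower_semicontinuous_def le_Liminf_iff by blast
  then show ?thesis
    using assms(2) by (auto simp: eventually_at_filter elim: eventually_mono)
qed

lemma open_superlevel_lower_semicontinuous:
  assumes "lower_semicontinuous H"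
  shows "open {x. c < H x}"
  using lower_semicontinuous_eventually_greater[OF assms]
  unfolding open_subopen[of "{x. c < H x}"] eventually_nhds subset_eq mem_Collect_eq
  by blast

text \<open>If the infimum \<open>m\<close> were not attained, the open superlevel sets \<open>{H > c}\<close> with \<open>c > m\<close> would
  cover a large ball. By compactness a single \<open>c > m\<close> bounds \<open>H\<close> from below on the ball, and
  coercivity provides such a bound outside it, so \<open>m\<close> would not be the greatest lower bound.\<close>

lemma lower_semicontinuous_coercive_attains_min:
  fixes H :: "'a::euclidean_space \<Rightarrow> ereal"
  assumes lsc: "lower_semicontinuous H" and coer: "coercive H"
  shows "\<exists>z. \<forall>y. H z \<le> H y"
proof (rule ccontr)
  assume no_min: "\<not> ?thesis"
  define m where "m = (INF y. H y)"
  have m_le: "m \<le> H y" for y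
    unfolding m_def by (rule INF_lower) simp
  have m_less: "m < H y" for y
    using no_min m_le by (metis order_le_less)
  \<comment> \<open>If \<open>H\<close> were constantly \<open>\<infinity>\<close>, every point would be a minimizer.\<close>
  have "m < \<infinity>"
    using m_less[of undefined] by auto
  then obtain r where r: "m < ereal r"
    using ereal_dense2 by blast
  have "eventually (\<lambda>y. ereal r < H y) at_infinity"
    using coer unfolding coercive_def tendsto_PInfty by blast
  then obtain R where R: "\<And>y. R \<le> norm y \<Longrightarrow> ereal r < H y"
    unfolding eventually_at_infinity by blast
  have cover: "cball 0 R \<subseteq> (\<Union>c\<in>{m<..}. {y. c < H y})"
    using m_less dense by fastforce
  obtain C where C: "C \<subseteq> {m<..}" "finite C" "cball 0 R \<subseteq> (\<Union>c\<in>C. {y. c < H y})"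
    using compactE_image[OF compact_cball open_superlevel_lower_semicontinuous[OF lsc] cover] by metis
  define c where "c = Min (insert (ereal r) C)"
  have "m < c"
    unfolding c_def using C r by (subst Min_gr_iff) auto
  moreover have "c \<le> H y" for y
  proof (cases "R \<le> norm y")
    case True
    then show ?thesis
      unfolding c_def using R[OF True] C(2) by (meson Min_le finite_insert insertI1 less_imp_le order_trans)
  next
    case False
    then have "y \<in> cball 0 R" by simp
    then obtain d where "d \<in> C" "d < H y"
      using C(3) by blast
    then show ?thesis
      unfolding c_def using C(2) by (meson Min_le finite_insert insertI2 less_imp_le order_trans)
  qed
  then have "c \<le> m"
    unfolding m_def by (rule INF_greatest)
  ultimately show False by simp
qed

text \<open>Semicontinuity is tested at a real level \<open>b\<close> below the sum, which is then split as
  \<open>(b - d) + d\<close> with strict room for each summand.\<close>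

lemma lower_semicontinuous_continuous_add:
  fixes c :: "'a::t2_space \<Rightarrow> real"
  assumes lsc: "lower_semicontinuous h" and ninf: "\<And>x. h x \<noteq> -\<infinity>" and cont: "\<And>x. isCont c x"
  shows "lower_semicontinuous (\<lambda>x. ereal (c x) + h x)"
  unfolding lower_semicontinuous_def le_Liminf_iff
proof (intro allI impI)
  fix x and a :: ereal
  assume "a < ereal (c x) + h x"
  then obtain b where ab: "a < ereal b" and b: "ereal b < ereal (c x) + h x"
    using ereal_dense2 by blast
  have "ereal (b - c x) < h x"
    using b by (cases "h x") auto
  then obtain d where bd: "b - c x < d" and d: "ereal d < h x"
    using ereal_dense2 by (metis less_ereal.simps(1))
  have ev_h: "eventually (\<lambda>y. ereal d < h y) (at x)"
    using lsc d unfolding lower_semicontinuous_def le_Liminf_iff by blast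
  have ev_c: "eventually (\<lambda>y. b - d < c y) (at x)"
    using cont[of x] bd unfolding isCont_def by (intro order_tendstoD(1)) auto
  show "eventually (\<lambda>y. a < ereal (c y) + h y) (at x)"
    using ev_h ev_c
  proof eventually_elim
    case (elim y)
    have "ereal b < ereal (c y) + h y"
      using elim by (cases "h y") auto
    then show ?case using ab by order
  qed
qed

lemma lower_semicontinuous_cmult:
  fixes h :: "'a::perfect_space \<Rightarrow> ereal"
  assumes "lower_semicontinuous h" "0 \<le> \<eta>"
  shows "lower_semicontinuous (\<lambda>x. ereal \<eta> * h x)"
  using assms unfolding lower_semicontinuous_def
  by (simp add: Liminf_ereal_mult_left ereal_mult_left_mono)


section \<open>Smooth convex functions\<close>

text \<open>The description defining the gradient denotes something: the derivative is a linear
  functional on a Euclidean space, and its value at \<open>1\<close> under the adjoint represents it.\<close>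

lemma GDERIV_gradient:
  fixes f :: "'a::euclidean_space \<Rightarrow> real"
  assumes "f differentiable (at x)"
  shows "GDERIV f x :> gradient f x"
proof -
  obtain f' where f': "(f has_derivative f') (at x)"
    using assms unfolding differentiable_def by blast
  have "f' h = h \<bullet> adjoint f' 1" for h
    using adjoint_works[OF has_derivative_linear[OF f'], of h 1] by simp
  then have D: "GDERIV f x :> adjoint f' 1"
    unfolding gderiv_def using f' by (metis (no_types, lifting) ext)
  have "E = D" if "GDERIV f x :> E" "GDERIV f x :> D" for D E
    using has_derivative_unique[OF that[unfolded gderiv_def]]
    by (metis vector_eq_ldot)
  then show ?thesis
    unfolding gradient_def by (metis D theI)
qed

lemma DERIV_along_line:
  fixes f :: "'a::euclidean_space \<Rightarrow> real"
  assumes "\<And>x. f differentiable (at x)"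
  shows "((\<lambda>t. f (x + t *\<^sub>R d)) has_real_derivative d \<bullet> gradient f (x + t *\<^sub>R d)) (at t)"
proof -
  have "(f has_derivative (\<lambda>h. h \<bullet> gradient f (x + t *\<^sub>R d))) (at (x + t *\<^sub>R d))"
    using GDERIV_gradient[OF assms] unfolding gderiv_def .
  then have "((\<lambda>t. f (x + t *\<^sub>R d)) has_derivative (\<lambda>s. (s *\<^sub>R d) \<bullet> gradient f (x + t *\<^sub>R d))) (at t)"
    by (rule has_derivative_compose[rotated]) (auto intro!: derivative_eq_intros)
  then show ?thesis
    unfolding has_field_derivative_def by (simp add: mult_commute_abs)
qed

text \<open>Along the segment from \<open>x\<close> to \<open>y\<close>, subtracting the claimed bound from \<open>f\<close> leaves a function
  whose derivative is nonpositive by Cauchy--Schwarz and the Lipschitz bound.\<close>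

lemma descent_lemma:
  fixes f :: "'a::euclidean_space \<Rightarrow> real"
  assumes "L_smooth L f"
  shows "f y \<le> f x + (y - x) \<bullet> gradient f x + L / 2 * (norm (y - x))\<^sup>2"
proof -
  have diff: "\<And>x. f differentiable (at x)"
    and lip: "\<And>x y. norm (gradient f x - gradient f y) \<le> L * norm (x - y)"
    using assms unfolding L_smooth_def by auto
  define d where "d = y - x"
  define \<phi> where "\<phi> t = f (x + t *\<^sub>R d) - t * (d \<bullet> gradient f x) - L / 2 * t\<^sup>2 * (norm d)\<^sup>2" for t
  have "\<phi> 1 \<le> \<phi> 0"
  proof (rule DERIV_nonpos_imp_nonincreasing[of 0 1 \<phi>])
    fix t :: real
    assume t: "0 \<le> t" "t \<le> 1"
    have "(\<phi> has_real_derivative d \<bullet> gradient f (x + t *\<^sub>R d) - d \<bullet> gradient f x - L * t * (norm d)\<^sup>2) (at t)"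
      unfolding \<phi>_def by (rule derivative_eq_intros DERIV_along_line diff refl | simp)+
    moreover have "d \<bullet> gradient f (x + t *\<^sub>R d) - d \<bullet> gradient f x \<le> L * t * (norm d)\<^sup>2"
    proof -
      have "d \<bullet> (gradient f (x + t *\<^sub>R d) - gradient f x)
          \<le> norm d * norm (gradient f (x + t *\<^sub>R d) - gradient f x)"
        by (rule norm_cauchy_schwarz)
      also have "\<dots> \<le> norm d * (L * norm (t *\<^sub>R d))"
        using lip[of "x + t *\<^sub>R d" x] by (intro mult_left_mono) auto
      also have "\<dots> = L * t * (norm d)\<^sup>2"
        using t by (simp add: power2_eq_square)
      finally show ?thesis by (simp add: inner_diff_right)
    qed
    ultimately show "\<exists>y. (\<phi> has_real_derivative y) (at t) \<and> y \<le> 0"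
      by (metis diff_le_0_iff_le)
  qed simp
  then show ?thesis
    by (simp add: \<phi>_def d_def)
qed

lemma convex_above_tangent_gradient:
  fixes f :: "'a::euclidean_space \<Rightarrow> real"
  assumes conv: "convex_on UNIV f" and diff: "\<And>x. f differentiable (at x)"
  shows "f x + (y - x) \<bullet> gradient f x \<le> f y"
proof -
  define \<phi> where "\<phi> t = f (x + t *\<^sub>R (y - x))" for t :: real
  have "convex_on UNIV \<phi>"
  proof (rule convex_onI)
    fix t a b :: real
    assume t: "0 < t" "t < 1"
    have "x + ((1 - t) *\<^sub>R a + t *\<^sub>R b) *\<^sub>R (y - x)
        = (1 - t) *\<^sub>R (x + a *\<^sub>R (y - x)) + t *\<^sub>R (x + b *\<^sub>R (y - x))"
      by (simp add: algebra_simps)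
    then show "\<phi> ((1 - t) *\<^sub>R a + t *\<^sub>R b) \<le> (1 - t) * \<phi> a + t * \<phi> b"
      unfolding \<phi>_def using convex_onD[OF conv, of t] t by simp
  qed simp
  moreover have "(\<phi> has_real_derivative (y - x) \<bullet> gradient f x) (at 0 within UNIV)"
    unfolding \<phi>_def using DERIV_along_line[OF diff, of x "y - x" 0] by simp
  ultimately have "\<phi> 1 - \<phi> 0 \<ge> ((y - x) \<bullet> gradient f x) * (1 - 0)"
    by (intro convex_on_imp_above_tangent) auto
  then show ?thesis by (simp add: \<phi>_def)
qed


section \<open>The proximal gradient step\<close>

lemma norm_sq_convex_combination:
  fixes p y :: "'a::real_inner"
  shows "(norm (s *\<^sub>R y + (1 - s) *\<^sub>R p))\<^sup>2
    = s * (norm y)\<^sup>2 + (1 - s) * (norm p)\<^sup>2 - s * (1 - s) * (norm (y - p))\<^sup>2"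
  unfolding power2_norm_eq_inner by (simp add: algebra_simps inner_commute)

text \<open>The objective is 1-strongly convex. Comparing the minimizer \<open>p\<close> with
  \<open>p + s (y - p)\<close> and dividing by \<open>s\<close> gives the claim with \<open>1 - s\<close> in front of the growth term;
  then \<open>s\<close> tends to \<open>0\<close>.\<close>

lemma prox_objective_quadratic_growth:
  fixes g :: "'a::real_inner \<Rightarrow> ereal"
  assumes conv: "ereal_convex g" and \<eta>: "0 \<le> \<eta>"
    and min: "\<And>y. ereal (1/2 * (norm (p - u))\<^sup>2) + ereal \<eta> * g p
              \<le> ereal (1/2 * (norm (y - u))\<^sup>2) + ereal \<eta> * g y"
    and gp: "g p = ereal gp" and gy: "g y = ereal gy"
    and proper: "\<And>x. g x \<noteq> -\<infinity>"
  shows "(norm (p - u))\<^sup>2 / 2 + \<eta> * gp + (norm (y - p))\<^sup>2 / 2 \<le> (norm (y - u))\<^sup>2 / 2 + \<eta> * gy"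
proof -
  define A where "A = (norm (p - u))\<^sup>2 / 2 + \<eta> * gp"
  define B where "B = (norm (y - u))\<^sup>2 / 2 + \<eta> * gy"
  define N where "N = (norm (y - p))\<^sup>2 / 2"
  have "A + (1 - s) * N \<le> B" if s: "0 < s" "s < 1" for s :: real
  proof -
    define w where "w = s *\<^sub>R y + (1 - s) *\<^sub>R p"
    have "g w \<le> ereal s * g y + ereal (1 - s) * g p"
      using conv s unfolding ereal_convex_def w_def by simp
    then have "g w \<le> ereal (s * gy + (1 - s) * gp)"
      by (simp add: gp gy)
    then obtain gw where gw: "g w = ereal gw" "gw \<le> s * gy + (1 - s) * gp"
      using proper[of w] by (cases "g w") auto
    have "w - u = s *\<^sub>R (y - u) + (1 - s) *\<^sub>R (p - u)"
      by (simp add: w_def algebra_simps)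
    then have norm_w: "(norm (w - u))\<^sup>2
        = s * (norm (y - u))\<^sup>2 + (1 - s) * (norm (p - u))\<^sup>2 - s * (1 - s) * (norm (y - p))\<^sup>2"
      using norm_sq_convex_combination[of s "y - u" "p - u"] by simp
    have "A \<le> (norm (w - u))\<^sup>2 / 2 + \<eta> * gw"
      using min[of w] by (simp add: A_def gp gw)
    also have "\<dots> \<le> (norm (w - u))\<^sup>2 / 2 + \<eta> * (s * gy + (1 - s) * gp)"
      using gw(2) \<eta> by (simp add: mult_left_mono)
    also have "\<dots> = s * B + (1 - s) * A - s * ((1 - s) * N)"
      unfolding norm_w A_def B_def N_def by (simp add: field_simps)
    finally have "s * (A + (1 - s) * N) \<le> s * B"
      by (simp add: algebra_simps)
    then show ?thesis using s by simp
  qed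
  then have "eventually (\<lambda>s. A + (1 - s) * N \<le> B) (at_right 0)"
    by (intro eventually_at_rightI[of 0 1]) auto
  moreover have "((\<lambda>s. A + (1 - s) * N) \<longlongrightarrow> A + (1 - 0) * N) (at_right 0)"
    by (intro tendsto_intros)
  ultimately have "A + (1 - 0) * N \<le> B"
    by (intro tendsto_upperbound) auto
  then show ?thesis by (simp add: A_def B_def N_def)
qed

lemma prox_minimizes:
  assumes "\<exists>z. \<forall>y. ereal (1/2 * (norm (z - u))\<^sup>2) + ereal \<eta> * g z
              \<le> ereal (1/2 * (norm (y - u))\<^sup>2) + ereal \<eta> * g y"
  shows "ereal (1/2 * (norm (prox \<eta> g u - u))\<^sup>2) + ereal \<eta> * g (prox \<eta> g u)
              \<le> ereal (1/2 * (norm (y - u))\<^sup>2) + ereal \<eta> * g y"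
  using assms unfolding prox_def arg_min_def is_arg_min_linorder
  by - (drule someI_ex, simp)

text \<open>Completing the square: up to a constant, the quadratic term of the proximal
  objective centred at the gradient step is \<open>1/L\<close> times the quadratic model of \<open>f\<close> at \<open>x\<close>.\<close>

lemma gradient_step_norm_sq:
  fixes x y v :: "'a::real_inner"
  assumes "L > 0"
  shows "L * ((norm (y - (x - (1/L) *\<^sub>R v)))\<^sup>2 / 2)
    = L / 2 * (norm (y - x))\<^sup>2 + (y - x) \<bullet> v + (norm v)\<^sup>2 / (2 * L)"
proof -
  have shift: "y - (x - (1/L) *\<^sub>R v) = (y - x) + (1/L) *\<^sub>R v" by simp
  have "(norm (y - (x - (1/L) *\<^sub>R v)))\<^sup>2
      = (norm (y - x))\<^sup>2 + 2 / L * ((y - x) \<bullet> v) + (norm v)\<^sup>2 / L\<^sup>2"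
    unfolding shift power2_norm_eq_inner
    by (simp add: inner_add_left inner_add_right inner_commute power2_eq_square del: diff_add_eq)
  then show ?thesis
    using assms by (simp add: field_simps power2_eq_square)
qed

text \<open>By the descent lemma, \<open>L\<close> times the proximal objective dominates \<open>F\<close> up to a constant, so it is
  coercive. Hence the choice made by \<^const>\<open>prox\<close> is a true minimizer.\<close>

lemma pg_objective_attains_min:
  fixes f :: "'a::euclidean_space \<Rightarrow> real" and F g :: "'a \<Rightarrow> ereal" and x :: 'a
  assumes F_eq: "\<And>u. F u = ereal (f u) + g u" and smooth: "L_smooth L f"
    and g_proper: "proper_fun g" and g_lsc: "lower_semicontinuous g" and coer: "coercive F"
  defines "u \<equiv> x - (1/L) *\<^sub>R gradient f x"
  shows "\<exists>z. \<forall>y. ereal (1/2 * (norm (z - u))\<^sup>2) + ereal (1/L) * g z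
              \<le> ereal (1/2 * (norm (y - u))\<^sup>2) + ereal (1/L) * g y"
proof (rule lower_semicontinuous_coercive_attains_min)
  have L: "L > 0" using smooth by (simp add: L_smooth_def)
  have ninf: "g y \<noteq> -\<infinity>" for y using g_proper by (simp add: proper_fun_def)
  have "ereal (1/L) * g y \<noteq> -\<infinity>" for y
    using ninf[of y] L by (cases "g y") auto
  then show "lower_semicontinuous (\<lambda>y. ereal (1/2 * (norm (y - u))\<^sup>2) + ereal (1/L) * g y)"
    using L g_lsc by (intro lower_semicontinuous_continuous_add lower_semicontinuous_cmult) auto
  show "coercive (\<lambda>y. ereal (1/2 * (norm (y - u))\<^sup>2) + ereal (1/L) * g y)"
    unfolding coercive_def tendsto_PInfty
  proof
    fix r :: real
    \<comment> \<open>The level of \<open>F\<close> that the domination turns into the level \<open>r\<close> of the proximal objective.\<close>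
    define r' where "r' = L * r + f x - (norm (gradient f x))\<^sup>2 / (2 * L)"
    have "eventually (\<lambda>y. ereal r' < F y) at_infinity"
      using coer unfolding coercive_def tendsto_PInfty by blast
    then show "eventually (\<lambda>y. ereal r < ereal (1/2 * (norm (y - u))\<^sup>2) + ereal (1/L) * g y) at_infinity"
    proof eventually_elim
      case (elim y)
      show ?case
      proof (cases "g y")
        case (real gy)
        have "L * r < L * (1/2 * (norm (y - u))\<^sup>2 + 1/L * gy)"
          using elim descent_lemma[OF smooth, of y x] gradient_step_norm_sq[OF L, of y x "gradient f x"] L
          by (simp add: real F_eq r'_def u_def distrib_left add_divide_distrib)
        then have "r < 1/2 * (norm (y - u))\<^sup>2 + 1/L * gy"
          using L mult_less_cancel_left_pos by blast
        then show ?thesis by (simp add: real)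
      qed (use ninf L in auto)
    qed
  qed
qed

text \<open>Quadratic growth of the proximal objective, rescaled by \<open>L\<close>, compares the model
  of \<open>F\<close> at the two points \<open>p\<close> and \<open>y\<close>. The descent lemma turns its value at \<open>p\<close> into an upper
  bound of \<open>F p\<close>, and the tangent inequality bounds its value at \<open>y\<close> by \<open>F y\<close> plus the quadratic
  term.\<close>

lemma pg_step_three_point:
  fixes f :: "'a::euclidean_space \<Rightarrow> real" and F g :: "'a \<Rightarrow> ereal" and x :: 'a
  assumes F_eq: "\<And>u. F u = ereal (f u) + g u"
    and f_convex: "convex_on UNIV f" and smooth: "L_smooth L f"
    and g_proper: "proper_fun g" and g_lsc: "lower_semicontinuous g" and g_convex: "ereal_convex g"
    and coer: "coercive F" and y: "F y < \<infinity>"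
  defines "p \<equiv> pg_step L f g x"
  shows "F p + ereal (L / 2 * (norm (y - p))\<^sup>2) \<le> F y + ereal (L / 2 * (norm (y - x))\<^sup>2)"
proof -
  define u where "u = x - (1/L) *\<^sub>R gradient f x"
  have L: "L > 0" and diff: "\<And>x. f differentiable (at x)"
    using smooth by (auto simp: L_smooth_def)
  have ninf: "g z \<noteq> -\<infinity>" for z using g_proper by (simp add: proper_fun_def)
  have p_min: "ereal (1/2 * (norm (p - u))\<^sup>2) + ereal (1/L) * g p
              \<le> ereal (1/2 * (norm (z - u))\<^sup>2) + ereal (1/L) * g z" for z
    unfolding p_def pg_step_def u_def
    by (intro prox_minimizes pg_objective_attains_min[OF F_eq smooth g_proper g_lsc coer])
  obtain gy where gy: "g y = ereal gy"
    using y ninf[of y] by (cases "g y") (auto simp: F_eq)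
  obtain gp where gp: "g p = ereal gp"
    using p_min[of y] ninf[of p] L by (cases "g p") (auto simp: gy)
  have "(norm (p - u))\<^sup>2 / 2 + 1/L * gp + (norm (y - p))\<^sup>2 / 2 \<le> (norm (y - u))\<^sup>2 / 2 + 1/L * gy"
    using prox_objective_quadratic_growth[OF g_convex _ p_min gp gy ninf] L by simp
  then have "L * ((norm (p - u))\<^sup>2 / 2 + 1/L * gp + (norm (y - p))\<^sup>2 / 2)
      \<le> L * ((norm (y - u))\<^sup>2 / 2 + 1/L * gy)"
    using L by (intro mult_left_mono) auto
  then have "L * ((norm (p - u))\<^sup>2 / 2) + gp + L / 2 * (norm (y - p))\<^sup>2
      \<le> L * ((norm (y - u))\<^sup>2 / 2) + gy"
    using L by (simp add: distrib_left)
  then have "f p + gp + L / 2 * (norm (y - p))\<^sup>2 \<le> f y + gy + L / 2 * (norm (y - x))\<^sup>2"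
    using gradient_step_norm_sq[OF L, of p x "gradient f x"]
      gradient_step_norm_sq[OF L, of y x "gradient f x"]
      descent_lemma[OF smooth, of p x] convex_above_tangent_gradient[OF f_convex diff, of x y]
    unfolding u_def by linarith
  then show ?thesis by (simp add: F_eq gp gy)
qed


section \<open>Rates for real sequences\<close>

lemma filterlim_div2: "filterlim (\<lambda>n::nat. n div 2) sequentially sequentially"
  unfolding filterlim_at_top eventually_sequentially
  by (metis div_le_mono nonzero_mult_div_cancel_left zero_neq_numeral)

text \<open>The \<open>n - n div 2 \<ge> n/2\<close> terms with index in \<open>[n div 2, n)\<close> are all at least \<open>a n\<close>, and
  their sum is a difference of two partial sums with the same limit.\<close>

lemma decseq_summable_imp_tendsto:
  fixes a :: "nat \<Rightarrow> real"
  assumes dec: "decseq a" and nonneg: "\<And>n. 0 \<le> a n" and summ: "summable a"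
  shows "(\<lambda>n. real n * a n) \<longlonglongrightarrow> 0"
proof (rule tendsto_sandwich[OF always_eventually always_eventually tendsto_const])
  define S where "S n = sum a {..<n}" for n
  define h :: "nat \<Rightarrow> nat" where "h n = n div 2" for n
  show "\<forall>n. 0 \<le> real n * a n" using nonneg by simp
  show "\<forall>n. real n * a n \<le> 2 * (S n - S (h n))"
  proof
    fix n
    have "real (n - h n) * a n = (\<Sum>k\<in>{h n..<n}. a n)" by simp
    also have "\<dots> \<le> (\<Sum>k\<in>{h n..<n}. a k)"
      using dec by (intro sum_mono) (auto simp: decseq_def)
    also have "\<dots> = S n - S (h n)"
      unfolding S_def h_def by (simp add: lessThan_atLeast0 sum_diff_nat_ivl)
    finally have "real (n - h n) * a n \<le> S n - S (h n)" .
    moreover have "real n * a n \<le> 2 * real (n - h n) * a n"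
      using nonneg[of n] by (intro mult_right_mono) (auto simp: h_def)
    ultimately show "real n * a n \<le> 2 * (S n - S (h n))" by simp
  qed
  have S: "S \<longlonglongrightarrow> suminf a"
    unfolding S_def by (rule summable_LIMSEQ[OF summ])
  moreover have "(\<lambda>n. S (h n)) \<longlonglongrightarrow> suminf a"
    unfolding h_def by (rule filterlim_compose[OF S filterlim_div2])
  ultimately have "(\<lambda>n. 2 * (S n - S (h n))) \<longlonglongrightarrow> 2 * (suminf a - suminf a)"
    by (intro tendsto_intros)
  then show "(\<lambda>n. 2 * (S n - S (h n))) \<longlonglongrightarrow> 0" by simp
qed

lemma smallo_inverse_natI:
  fixes a :: "nat \<Rightarrow> real"
  assumes "(\<lambda>n. real n * a n) \<longlonglongrightarrow> 0"
  shows "a \<in> o(\<lambda>n. 1 / real n)"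
  using assms by (intro smalloI_tendsto) (auto simp: mult.commute eventually_sequentially intro!: exI[of _ 1])

text \<open>Summing the decrease over \<open>k \<in> (t div 2, t]\<close> bounds \<open>t/2\<close> times the squared minimum by
  \<open>c\<close> times the value of \<open>D\<close> at the beginning of the window. The hypothesis makes that value
  \<open>o(1/t)\<close>, which gains a full factor \<open>1/t\<close> for the minimum where a bounded \<open>D\<close> would only give
  \<open>1/\<surd>t\<close>.\<close>

lemma min_increment_rate:
  fixes D w :: "nat \<Rightarrow> real"
  assumes D_nonneg: "\<And>n. n \<ge> 1 \<Longrightarrow> 0 \<le> D n" and w_nonneg: "\<And>n. 0 \<le> w n" and c: "0 \<le> c"
    and decrease: "\<And>n. n \<ge> 1 \<Longrightarrow> (w n)\<^sup>2 \<le> c * (D n - D (n + 1))"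
    and rate: "(\<lambda>n. real n * D (n + 1)) \<longlonglongrightarrow> 0"
  shows "(\<lambda>t. real t * (MIN \<tau>\<in>{1..t}. w \<tau>)) \<longlonglongrightarrow> 0"
proof -
  define M where "M t = (MIN \<tau>\<in>{1..t}. w \<tau>)" for t
  define h :: "nat \<Rightarrow> nat" where "h t = t div 2" for t
  \<comment> \<open>The constant 6 is 2 from the window length \<open>t - t div 2 \<ge> t/2\<close> times 3 from
    \<open>t \<le> 3 (t div 2)\<close>, which holds from \<open>t = 2\<close> on.\<close>
  have bound: "(real t * M t)\<^sup>2 \<le> 6 * c * (real (h t) * D (h t + 1))" if t: "t \<ge> 2" for t
  proof -
    have M_le: "M t \<le> w k" if "k \<in> {1..t}" for k
      unfolding M_def using that by (intro Min_le) auto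
    have M_nonneg: "0 \<le> M t"
      unfolding M_def using t w_nonneg by (subst Min_ge_iff) auto
    have "real (t - h t) * (M t)\<^sup>2 = (\<Sum>k\<in>{h t + 1..<t + 1}. (M t)\<^sup>2)" by simp
    also have "\<dots> \<le> (\<Sum>k\<in>{h t + 1..<t + 1}. c * (D k - D (k + 1)))"
    proof (rule sum_mono)
      fix k assume k: "k \<in> {h t + 1..<t + 1}"
      then have "(M t)\<^sup>2 \<le> (w k)\<^sup>2"
        using M_le[of k] M_nonneg by (intro power_mono) auto
      also have "\<dots> \<le> c * (D k - D (k + 1))"
        using k by (intro decrease) auto
      finally show "(M t)\<^sup>2 \<le> c * (D k - D (k + 1))" .
    qed
    also have "\<dots> = c * (D (h t + 1) - D (t + 1))"
      using sum_Suc_diff'[of "h t + 1" "t + 1" "\<lambda>k. - D k"]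
      by (simp add: sum_distrib_left[symmetric] h_def)
    also have "\<dots> \<le> c * D (h t + 1)"
      using D_nonneg[of "t + 1"] c by (intro mult_left_mono) auto
    finally have window: "real (t - h t) * (M t)\<^sup>2 \<le> c * D (h t + 1)" .
    have "(real t * M t)\<^sup>2 = real t * (real t * (M t)\<^sup>2)"
      by (simp add: power2_eq_square)
    also have "\<dots> \<le> real t * (2 * real (t - h t) * (M t)\<^sup>2)"
      by (intro mult_left_mono mult_right_mono) (auto simp: h_def)
    also have "\<dots> \<le> real t * (2 * (c * D (h t + 1)))"
      using window by (intro mult_left_mono) auto
    also have "\<dots> \<le> (3 * real (h t)) * (2 * (c * D (h t + 1)))"
    proof (rule mult_right_mono)
      have "t \<le> 3 * h t" using t by (simp add: h_def)
      then show "real t \<le> 3 * real (h t)" by linarith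
    qed (use c D_nonneg in auto)
    finally show ?thesis by (simp add: mult_ac)
  qed
  have "(\<lambda>t. real (h t) * D (h t + 1)) \<longlonglongrightarrow> 0"
    unfolding h_def by (rule filterlim_compose[OF rate filterlim_div2])
  then have lim: "(\<lambda>t. 6 * c * (real (h t) * D (h t + 1))) \<longlonglongrightarrow> 0"
    by (rule tendsto_mult_right_zero)
  have "(\<lambda>t. (real t * M t)\<^sup>2) \<longlonglongrightarrow> 0"
    by (rule tendsto_sandwich[OF _ _ tendsto_const lim])
      (use bound in \<open>auto simp: eventually_sequentially\<close>)
  then have "(\<lambda>t. \<bar>real t * M t\<bar>) \<longlonglongrightarrow> 0"
    using tendsto_real_sqrt by fastforce
  then show ?thesis
    unfolding M_def by (simp add: tendsto_rabs_zero_iff)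
qed


section \<open>Convergence of the proximal gradient method\<close>

theorem theorem4:
  fixes f :: "real ^ 'd \<Rightarrow> real" and g F :: "real ^ 'd \<Rightarrow> ereal"
    and L :: real and Fstar :: ereal and x :: "nat \<Rightarrow> real ^ 'd"
  assumes F_eq: "\<And>u. F u = ereal (f u) + g u"
    and f_convex: "convex_on UNIV f" and f_smooth: "L_smooth L f"
    and g_proper: "proper_fun g" and g_lsc: "lower_semicontinuous g" and g_convex: "ereal_convex g"
    and F_proper: "proper_fun F" and F_coercive: "coercive F" and F_convex: "ereal_convex F"
    and F_lsc: "lower_semicontinuous F" and F_semialg: "semialgebraic_fun F"
    and Fstar_eq: "Fstar = (INF u. F u)"
    and x0_dom: "x 0 \<in> effective_domain F"
    and x_pg: "pg_sequence L f g x"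
  shows "(\<exists>z. F z = Fstar) \<and> \<bar>Fstar\<bar> \<noteq> \<infinity> \<and> (\<forall>t. \<bar>F (x (t + 1))\<bar> \<noteq> \<infinity>) \<and>
     (\<lambda>t. real_of_ereal (F (x (t + 1)) - Fstar)) \<in> o(\<lambda>t. 1 / real t) \<and>
     (\<lambda>t. MIN \<tau>\<in>{1..t}. norm (prox_gradient L f g (x \<tau>))) \<in> o(\<lambda>t. 1 / real t)"
proof -
  have L: "L > 0" using f_smooth by (simp add: L_smooth_def)
  note three_point = pg_step_three_point[OF F_eq f_convex f_smooth g_proper g_lsc g_convex F_coercive]
  have step: "x (\<tau> + 1) = pg_step L f g (x \<tau>)" if "\<tau> \<ge> 1" for \<tau>
    using x_pg that by (simp add: pg_sequence_def)
  have F_ninf: "F y \<noteq> -\<infinity>" for y using F_proper by (simp add: proper_fun_def)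

  obtain z where z: "\<And>y. F z \<le> F y"
    using lower_semicontinuous_coercive_attains_min[OF F_lsc F_coercive] by blast
  have Fz: "F z = Fstar"
    unfolding Fstar_eq by (intro antisym INF_greatest INF_lower z) simp
  have x0: "F (x 0) < \<infinity>" using x0_dom by (simp add: effective_domain_def)
  then have "F z < \<infinity>" using z order_le_less_trans by blast
  then obtain m where m: "F z = ereal m" using F_ninf[of z] by (cases "F z") auto

  have Fx_less: "F (x (t + 1)) < \<infinity>" for t
  proof (induction t)
    case 0
    then show ?case using x0 x_pg by (simp add: pg_sequence_def)
  next
    case (Suc t)
    have "F (x (t + 1 + 1)) + ereal (L / 2 * (norm (x (t + 1) - x (t + 1 + 1)))\<^sup>2)
        \<le> F (x (t + 1)) + ereal (L / 2 * (norm (x (t + 1) - x (t + 1)))\<^sup>2)"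
      using three_point[OF Suc, of "x (t + 1)"] step[of "t + 1"] by simp
    with Suc show ?case by auto
  qed
  \<comment> \<open>The optimality gaps, as real numbers.\<close>
  define D where "D n = real_of_ereal (F (x n)) - m" for n
  have Fx: "F (x n) = ereal (D n + m)" if "n \<ge> 1" for n
    using Fx_less[of "n - 1"] F_ninf[of "x n"] that by (cases "F (x n)") (auto simp: D_def)
  have D_nonneg: "0 \<le> D n" if "n \<ge> 1" for n
    using z[of "x n"] Fx[OF that] by (simp add: m)
  have D_descent: "D (n + 1) + L / 2 * (norm (x n - x (n + 1)))\<^sup>2 \<le> D n" if n: "n \<ge> 1" for n
    using three_point[of "x n" "x n"] step[OF n] Fx[OF n] Fx[of "n + 1"] by simp
  have D_telescope: "D (n + 1) \<le> L / 2 * ((norm (z - x n))\<^sup>2 - (norm (z - x (n + 1)))\<^sup>2)"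
    if n: "n \<ge> 1" for n
    using three_point[of z "x n"] step[OF n] Fx[of "n + 1"] by (simp add: m algebra_simps)

  have D_rate: "(\<lambda>n. real n * D (n + 1)) \<longlonglongrightarrow> 0"
  proof (rule decseq_summable_imp_tendsto)
    show "decseq (\<lambda>n. D (n + 1))"
    proof (rule decseq_SucI)
      fix n
      show "D (Suc n + 1) \<le> D (n + 1)"
        using D_descent[of "n + 1"] L by (simp add: add_increasing2 order_trans[rotated])
    qed
    show "0 \<le> D (n + 1)" for n by (rule D_nonneg) simp
    have partial: "(\<Sum>k<n. D (k + 1 + 1)) \<le> L / 2 * (norm (z - x 1))\<^sup>2" for n
    proof -
      have "(\<Sum>k<n. D (k + 1 + 1))
          \<le> (\<Sum>k<n. L / 2 * ((norm (z - x (k + 1)))\<^sup>2 - (norm (z - x (k + 1 + 1)))\<^sup>2))"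
        by (intro sum_mono D_telescope) simp
      also have "\<dots> = L / 2 * ((norm (z - x 1))\<^sup>2 - (norm (z - x (n + 1)))\<^sup>2)"
        using sum_lessThan_telescope'[of "\<lambda>k. (norm (z - x (k + 1)))\<^sup>2" n]
        by (subst sum_distrib_left[symmetric]) simp
      also have "\<dots> \<le> L / 2 * (norm (z - x 1))\<^sup>2"
        using L by (intro mult_left_mono) auto
      finally show ?thesis .
    qed
    have "summable (\<lambda>n. D (n + 1 + 1))"
      by (rule summableI_nonneg_bounded[OF _ partial]) (simp add: D_nonneg)
    then show "summable (\<lambda>n. D (n + 1))"
      using summable_Suc_iff[of "\<lambda>n. D (n + 1)"] by simp
  qed

  have "(\<lambda>t. real t * (MIN \<tau>\<in>{1..t}. norm (prox_gradient L f g (x \<tau>)))) \<longlonglongrightarrow> 0"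
  proof (rule min_increment_rate[OF _ _ _ _ D_rate])
    fix n :: nat
    assume n: "n \<ge> 1"
    show "0 \<le> D n" by (rule D_nonneg[OF n])
    have "norm (prox_gradient L f g (x n)) = L * norm (x n - x (n + 1))"
      using L by (simp add: prox_gradient_def flip: step[OF n])
    then have "(norm (prox_gradient L f g (x n)))\<^sup>2 = 2 * L * (L / 2 * (norm (x n - x (n + 1)))\<^sup>2)"
      by (simp add: power2_eq_square)
    also have "\<dots> \<le> 2 * L * (D n - D (n + 1))"
      using D_descent[OF n] L by (intro mult_left_mono) auto
    finally show "(norm (prox_gradient L f g (x n)))\<^sup>2 \<le> 2 * L * (D n - D (n + 1))" .
  qed (use L in auto)
  then have G_smallo: "(\<lambda>t. MIN \<tau>\<in>{1..t}. norm (prox_gradient L f g (x \<tau>))) \<in> o(\<lambda>t. 1 / real t)"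
    by (rule smallo_inverse_natI)
  have "real_of_ereal (F (x (t + 1)) - Fstar) = D (t + 1)" for t
    unfolding Fz[symmetric] using Fx[of "t + 1"] by (simp add: m)
  then have F_smallo: "(\<lambda>t. real_of_ereal (F (x (t + 1)) - Fstar)) \<in> o(\<lambda>t. 1 / real t)"
    using smallo_inverse_natI[OF D_rate] by presburger
  have "\<bar>F (x (t + 1))\<bar> \<noteq> \<infinity>" for t
    using Fx[of "t + 1"] by simp
  moreover have "\<bar>Fstar\<bar> \<noteq> \<infinity>"
    unfolding Fz[symmetric] by (simp add: m)
  ultimately show ?thesis
    using Fz G_smallo F_smallo by blast
qed

end
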